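(* Let $\mathcal{A}$ be a (randomized) algorithm that solves the wake-up problem in $f(n,\mathcal{C})$ rounds, in expectation, in the radio network model with $\mathcal{C}\ge 1$ channels and no collision detection (that is, for every network size $n$, every number of channels $\mathcal{C}\ge1$ and every non-empty set of activated nodes, the expected number of rounds until the problem is solved is at most $f(n,\mathcal{C})$). Then for every $\mathcal{C}\ge 1$, $f(n,\mathcal{C})\in\Omega\!\left(\frac{\log n}{\mathcal{C}}+1\right)$.
   Context: Multichannel radio network model (single hop, no collision detection): there are $n$ nodes with unique ids from $[n]=\{1,\dots,n\}$, every two of which are neighbors, and $\mathcal{C}\ge1$ orthogonal channels. Executions proceed in synchronous rounds. In each round each node chooses a single channel and either transmits a message or receives on it. A node $u$ receives a message from $v$ on channel $c$ in a round if and only if $u$ receives on $c$, $v$ transmits on $c$, and no other neighbor of $u$ transmits on $c$ in that round; otherwise $u$ receives nothing, and nodes cannot distinguish silence from collision. Wake-up problem: all nodes are initially inactive; at the beginning of the execution an adversary activates an arbitrary non-empty subset of the nodes. Inactive nodes can only listen, all on the same known default channel (channel $1$); active nodes execute an arbitrary randomized algorithm and have no advance knowledge of the identities of the other active nodes. The problem is solved in the first round in which exactly one active node transmits on channel $1$. Asymptotics are in $n\to\infty$, with $\mathcal{C}$ quantified first as in the claim. *)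

theory Defs
  imports "HOL-Probability.Probability" "HOL-Library.Landau_Symbols"
begin

section \<open>Single-hop multichannel radio network without collision detection\<close>

datatype 'm action = Transmit (channel: nat) 'm | Receive (channel: nat)

instance action :: (countable) countable
  by countable_datatype

definition transmits_on :: "'m action \<Rightarrow> nat \<Rightarrow> bool" where
  "transmits_on a c \<longleftrightarrow> (\<exists>m. a = Transmit c m)"

text \<open>
  The network is single hop: the neighbours of a node \<open>u\<close> are all other nodes in \<open>{1..n}\<close>.
\<close>

definition receives_from :: "nat \<Rightarrow> (nat \<Rightarrow> 'm action) \<Rightarrow> nat \<Rightarrow> nat \<Rightarrow> nat \<Rightarrow> 'm \<Rightarrow> bool" where
  "receives_from n a u v c m \<longleftrightarrow>
     a u = Receive c \<and> v \<in> {1..n} - {u} \<and> a v = Transmit c m \<and>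
     (\<forall>w \<in> {1..n} - {u}. w \<noteq> v \<longrightarrow> \<not> transmits_on (a w) c)"

text \<open>
  The value \<open>None\<close> stands for receiving nothing; silence, collision and the node itself
  transmitting all produce it. The message in the \<open>Some\<close> case is unique because at most one
  \<open>v\<close> satisfies \<^const>\<open>receives_from\<close>.
\<close>

definition reception :: "nat \<Rightarrow> (nat \<Rightarrow> 'm action) \<Rightarrow> nat \<Rightarrow> 'm option" where
  "reception n a u =
     (if \<exists>v c m. receives_from n a u v c m
      then Some (THE m. \<exists>v c. receives_from n a u v c m) else None)"

section \<open>Randomized protocols and their executions\<close>

text \<open>
  Randomness is modelled by private seeds. Before the execution every node \<open>u\<close> draws a seed
  from an arbitrary probability space \<open>seed P u\<close>, for instance an infinite sequence of coin
  flips, independently of the other nodes. What \<open>u\<close> does in a round, once activated, is a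
  function of its id, its seed and the list of its receptions in all previous rounds (oldest
  first). Its own earlier actions are determined by these data, and nothing else about the
  activated set is available to it.
\<close>

record ('s, 'm) protocol =
  seed :: "nat \<Rightarrow> 's measure"
  act :: "nat \<Rightarrow> 's \<Rightarrow> 'm option list \<Rightarrow> 'm action"

definition valid_protocol :: "nat \<Rightarrow> nat \<Rightarrow> ('s, 'm) protocol \<Rightarrow> bool" where
  "valid_protocol n C P \<longleftrightarrow>
     (\<forall>u \<in> {1..n}.
        prob_space (seed P u) \<and>
        (\<forall>h. (\<lambda>s. act P u s h) \<in> measurable (seed P u) (count_space UNIV)) \<and>
        (\<forall>s \<in> space (seed P u). \<forall>h. channel (act P u s h) \<in> {1..C}))"

text \<open>
  \<open>\<omega>\<close> assigns seeds to nodes and \<open>S\<close> is the set of activated nodes. Nodes outside \<open>S\<close> listen on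
  the default channel 1 throughout; the first round in which one of them could receive a
  message is a round in which the wake-up problem is already solved, so their behaviour
  after that is irrelevant.
\<close>

definition node_action ::
    "('s, 'm) protocol \<Rightarrow> nat set \<Rightarrow> (nat \<Rightarrow> 's) \<Rightarrow> (nat \<Rightarrow> 'm option list) \<Rightarrow> nat \<Rightarrow> 'm action" where
  "node_action P S \<omega> h u = (if u \<in> S then act P u (\<omega> u) (h u) else Receive 1)"

primrec history ::
    "nat \<Rightarrow> ('s, 'm) protocol \<Rightarrow> nat set \<Rightarrow> (nat \<Rightarrow> 's) \<Rightarrow> nat \<Rightarrow> nat \<Rightarrow> 'm option list" where
  "history n P S \<omega> 0 = (\<lambda>u. [])"
| "history n P S \<omega> (Suc r) =
     (\<lambda>u. history n P S \<omega> r u @ [reception n (node_action P S \<omega> (history n P S \<omega> r)) u])"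

text \<open>
  Rounds are numbered from 1; the actions of round \<open>r\<close> depend on the receptions in the
  \<open>r - 1\<close> earlier rounds.
\<close>

definition round_action ::
    "nat \<Rightarrow> ('s, 'm) protocol \<Rightarrow> nat set \<Rightarrow> (nat \<Rightarrow> 's) \<Rightarrow> nat \<Rightarrow> nat \<Rightarrow> 'm action" where
  "round_action n P S \<omega> r = node_action P S \<omega> (history n P S \<omega> (r - 1))"

section \<open>The wake-up problem\<close>

definition wakeup_round ::
    "nat \<Rightarrow> ('s, 'm) protocol \<Rightarrow> nat set \<Rightarrow> (nat \<Rightarrow> 's) \<Rightarrow> nat \<Rightarrow> bool" where
  "wakeup_round n P S \<omega> r \<longleftrightarrow> (\<exists>!u. u \<in> S \<and> transmits_on (round_action n P S \<omega> r u) 1)"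

text \<open>The infimum of the empty set is \<open>\<infinity>\<close>, the value for executions that never solve the problem.\<close>

definition wakeup_time ::
    "nat \<Rightarrow> ('s, 'm) protocol \<Rightarrow> nat set \<Rightarrow> (nat \<Rightarrow> 's) \<Rightarrow> enat" where
  "wakeup_time n P S \<omega> = (INF r \<in> {r. 1 \<le> r \<and> wakeup_round n P S \<omega> r}. enat r)"

definition expected_wakeup_time ::
    "nat \<Rightarrow> ('s, 'm) protocol \<Rightarrow> nat set \<Rightarrow> ennreal" where
  "expected_wakeup_time n P S =
     (\<integral>\<^sup>+ \<omega>. ennreal_of_enat (wakeup_time n P S \<omega>) \<partial>(\<Pi>\<^sub>M u \<in> {1..n}. seed P u))"

text \<open>
  An algorithm is given the network size \<open>n\<close> and the number \<open>C\<close> of channels. Messages come from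
  a countable type, which makes \<^const>\<open>wakeup_time\<close> measurable under the measurability
  condition in \<^const>\<open>valid_protocol\<close>.
\<close>

definition solves_wakeup_in ::
    "(nat \<Rightarrow> nat \<Rightarrow> ('s, 'm::countable) protocol) \<Rightarrow> (nat \<Rightarrow> nat \<Rightarrow> real) \<Rightarrow> bool" where
  "solves_wakeup_in A f \<longleftrightarrow>
     (\<forall>n C. 1 \<le> n \<longrightarrow> 1 \<le> C \<longrightarrow>
        valid_protocol n C (A n C) \<and>
        (\<forall>S. S \<noteq> {} \<and> S \<subseteq> {1..n} \<longrightarrow> expected_wakeup_time n (A n C) S \<le> ennreal (f n C)))"

end

theory Submission imports Defs begin

text \<open>
  As long as no channel carries exactly one transmission, nobody receives anything, so every node
  acts obliviously: its action is determined by its seed and the round number. Once the seeds are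
  fixed, \<open>R\<close> rounds on \<open>C\<close> channels thus amount to a family of \<open>R * C\<close> sets of would-be
  transmitters, and the problem can only be solved within \<open>R\<close> rounds if one of these sets meets
  the activated set \<open>S\<close> in exactly one node. Draw \<open>j\<close> uniformly from \<open>{1..L}\<close>, where \<open>L\<close> is about
  \<open>log 2 n\<close>, and put every node into \<open>S\<close> independently with probability \<open>1 / 2 ^ j\<close>: any fixed set
  meets \<open>S\<close> in exactly one node with probability at most \<open>2 / L\<close>. Averaging over seeds and \<open>S\<close>
  (Yao's principle) gives one non-empty \<open>S\<close> for which \<open>R < L / (8 * C)\<close> rounds fail with
  probability at least one half.
\<close>

section \<open>A random set that rarely meets a given set in exactly one element\<close>

text \<open>For \<open>S \<subseteq> A\<close>, the probability that independent coins of bias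
  \<open>p\<close>, one per element of \<open>A\<close>, select exactly \<open>S\<close>. Explicit
  weights turn averaging over \<open>S\<close> into finite sums.\<close>

definition bernoulli_weight :: "'a set \<Rightarrow> real \<Rightarrow> 'a set \<Rightarrow> real" where
  "bernoulli_weight A p S = p ^ card S * (1 - p) ^ card (A - S)"

lemma bernoulli_weight_nonneg: "0 \<le> p \<Longrightarrow> p \<le> 1 \<Longrightarrow> 0 \<le> bernoulli_weight A p S"
  by (simp add: bernoulli_weight_def)

lemma sum_bernoulli_weight:
  assumes "finite A"
  shows "(\<Sum>S\<in>Pow A. bernoulli_weight A p S) = 1"
  using prod_add[OF assms, of "\<lambda>_. p" "\<lambda>_. 1 - p"] by (simp add: bernoulli_weight_def)

text \<open>Exactly one success among the coins of \<open>F\<close>: \<open>S\<close> splits into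
  its single element of \<open>F\<close> and an arbitrary subset of \<open>A - F\<close>, whose
  weights sum to 1.\<close>

lemma sum_bernoulli_weight_singleton_inter:
  assumes "finite A" "F \<subseteq> A"
  shows "(\<Sum>S | S \<subseteq> A \<and> card (S \<inter> F) = 1. bernoulli_weight A p S)
           = real (card F) * p * (1 - p) ^ (card F - 1)"
proof -
  have finF: "finite F" using assms finite_subset by blast
  let ?h = "\<lambda>(u, S). insert u S"
  have inj: "inj_on ?h (F \<times> Pow (A - F))"
  proof (rule inj_onI)
    have "?h x \<inter> F = {fst x} \<and> ?h x - F = snd x" if "x \<in> F \<times> Pow (A - F)" for x
      using that by auto
    moreover fix x y assume "x \<in> F \<times> Pow (A - F)" "y \<in> F \<times> Pow (A - F)" "?h x = ?h y"
    ultimately show "x = y" by (metis prod.expand singleton_inject)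
  qed
  have img: "{S. S \<subseteq> A \<and> card (S \<inter> F) = 1} = ?h ` (F \<times> Pow (A - F))"
  proof (intro equalityI subsetI)
    fix S assume "S \<in> {S. S \<subseteq> A \<and> card (S \<inter> F) = 1}"
    then obtain u where "S \<subseteq> A" "S \<inter> F = {u}" by (auto simp: card_1_singleton_iff)
    then have "S = ?h (u, S - F)" "(u, S - F) \<in> F \<times> Pow (A - F)" by auto
    then show "S \<in> ?h ` (F \<times> Pow (A - F))" by (rule image_eqI)
  next
    fix S assume "S \<in> ?h ` (F \<times> Pow (A - F))"
    then obtain u X where "S = insert u X" "u \<in> F" "X \<subseteq> A - F" by auto
    then have "S \<inter> F = {u}" "S \<subseteq> A" using assms by auto
    then show "S \<in> {S. S \<subseteq> A \<and> card (S \<inter> F) = 1}" by simp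
  qed
  have weight: "bernoulli_weight A p (insert u X)
      = p * (1 - p) ^ (card F - 1) * bernoulli_weight (A - F) p X"
    if "u \<in> F" "X \<subseteq> A - F" for u X
  proof -
    have "finite X" "u \<notin> X" using that assms by (auto intro: finite_subset[of X A])
    moreover have "A - insert u X = (F - {u}) \<union> ((A - F) - X)" using that assms by auto
    then have "card (A - insert u X) = card (F - {u}) + card ((A - F) - X)"
      using finF assms by (simp add: card_Un_disjoint Int_Diff disjoint_iff)
    ultimately show ?thesis
      using that finF by (simp add: bernoulli_weight_def power_add)
  qed
  have "(\<Sum>S | S \<subseteq> A \<and> card (S \<inter> F) = 1. bernoulli_weight A p S)
      = (\<Sum>(u, X) \<in> F \<times> Pow (A - F). bernoulli_weight A p (insert u X))"
    unfolding img by (subst sum.reindex[OF inj]) (simp add: case_prod_unfold)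
  also have "\<dots> = (\<Sum>(u, X) \<in> F \<times> Pow (A - F).
                     p * (1 - p) ^ (card F - 1) * bernoulli_weight (A - F) p X)"
    by (rule sum.cong) (auto simp: weight)
  also have "\<dots> = (\<Sum>u\<in>F. p * (1 - p) ^ (card F - 1) * 1)"
    using assms by (simp add: sum.cartesian_product[symmetric] sum_distrib_left[symmetric]
        sum_bernoulli_weight)
  finally show ?thesis by simp
qed

text \<open>\<open>k * b ^ (k - 1)\<close> is the least slope of \<open>x ^ k\<close> on
  \<open>[b, a]\<close>. The truncated \<open>k - 1\<close> at \<open>k = 0\<close> is harmless,
  since the factor \<open>k\<close> vanishes.\<close>

lemma power_diff_ge:
  fixes a b :: real
  assumes "0 \<le> b" "b \<le> a"
  shows "real k * b ^ (k - 1) * (a - b) \<le> a ^ k - b ^ k"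
proof (induction k)
  case (Suc k)
  have "real k * b ^ k * (a - b) = b * (real k * b ^ (k - 1) * (a - b))"
    by (cases k) auto
  also have "\<dots> \<le> b * (a ^ k - b ^ k)"
    using Suc assms by (intro mult_left_mono) auto
  finally have "real (Suc k) * b ^ k * (a - b) \<le> b * (a ^ k - b ^ k) + b ^ k * (a - b)"
    by (simp add: algebra_simps)
  also have "\<dots> \<le> b * (a ^ k - b ^ k) + a ^ k * (a - b)"
    using assms by (intro add_left_mono mult_right_mono power_mono) auto
  also have "\<dots> = a ^ Suc k - b ^ Suc k" by (simp add: algebra_simps)
  finally show ?case by simp
qed simp

text \<open>
  Up to the factor 2, each summand is dominated by the increment of \<open>(1 - x) ^ k\<close> between
  \<open>x = 1 / 2 ^ j\<close> and \<open>x = 1 / 2 ^ (j + 1)\<close>, so the sum telescopes.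
\<close>

lemma sum_dyadic_singleton_le_2:
  "(\<Sum>j=1..L. real k * (1 / 2 ^ j) * (1 - 1 / 2 ^ j) ^ (k - 1)) \<le> (2 :: real)"
proof -
  let ?g = "\<lambda>j::nat. (1 - 1 / 2 ^ j :: real) ^ k"
  have "real k * (1 / 2 ^ j) * (1 - 1 / 2 ^ j) ^ (k - 1) \<le> 2 * (?g (Suc j) - ?g j)" for j
  proof -
    have "real k * (1 - 1 / 2 ^ j) ^ (k - 1) * ((1 - 1 / 2 ^ Suc j) - (1 - 1 / 2 ^ j))
        \<le> ?g (Suc j) - ?g j"
      by (rule power_diff_ge) (auto simp: field_simps)
    then show ?thesis by (simp add: field_simps)
  qed
  then have "(\<Sum>j=1..L. real k * (1 / 2 ^ j) * (1 - 1 / 2 ^ j) ^ (k - 1))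
      \<le> (\<Sum>j=1..L. 2 * (?g (Suc j) - ?g j))"
    by (rule sum_mono)
  also have "\<dots> = 2 * (?g (Suc L) - ?g 1)"
    unfolding sum_distrib_left[symmetric] by (subst sum_Suc_diff) auto
  also have "\<dots> \<le> 2 * (1 - 0)"
    by (intro mult_left_mono diff_mono power_le_one) (auto simp: divide_le_eq_1 simp flip: power_Suc)
  finally show ?thesis by simp
qed

text \<open>\<open>w\<close> mixes the Bernoulli weights uniformly over \<open>j\<close>. Dropping
  the empty set, which may not be activated, costs at most half of the mass; \<open>w\<close> is
  left unnormalised.\<close>

lemma rarely_singleton_weight:
  fixes A :: "'a set"
  assumes "finite A" "0 < L" "2 ^ L \<le> card A"
  obtains w :: "'a set \<Rightarrow> real" where
    "\<And>S. 0 \<le> w S"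
    "1 / 2 \<le> (\<Sum>S\<in>Pow A - {{}}. w S)"
    "\<And>F. F \<subseteq> A \<Longrightarrow> (\<Sum>S | S \<subseteq> A \<and> card (S \<inter> F) = 1. w S) \<le> 2 / L"
proof
  let ?b = "\<lambda>j. bernoulli_weight A (1 / 2 ^ j)"
  let ?w = "\<lambda>S. (\<Sum>j=1..L. ?b j S) / L"
  show "0 \<le> ?w S" for S
    by (intro divide_nonneg_nonneg sum_nonneg bernoulli_weight_nonneg) auto
  show "(\<Sum>S | S \<subseteq> A \<and> card (S \<inter> F) = 1. ?w S) \<le> 2 / L" if "F \<subseteq> A" for F
  proof -
    have "(\<Sum>S | S \<subseteq> A \<and> card (S \<inter> F) = 1. ?w S)
        = (\<Sum>j=1..L. \<Sum>S | S \<subseteq> A \<and> card (S \<inter> F) = 1. ?b j S) / L"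
      unfolding sum_divide_distrib[symmetric] by (subst sum.swap) simp
    also have "\<dots> \<le> 2 / L"
      using sum_dyadic_singleton_le_2[of "card F" L]
      by (simp only: sum_bernoulli_weight_singleton_inter[OF assms(1) that]) (simp add: divide_right_mono)
    finally show ?thesis .
  qed
  \<comment> \<open>Since \<open>card A / 2 ^ j \<ge> 1\<close> for every \<open>j\<close> up to
    \<open>L\<close>, the empty set is drawn with probability at most
    \<open>exp (- 1)\<close>.\<close>
  have empty: "?b j {} \<le> 1 / 2" if "j \<in> {1..L}" for j
  proof -
    have "(2::real) ^ j \<le> 2 ^ L" using that by (intro power_increasing) auto
    also have "\<dots> \<le> real (card A)" using assms(3) by (metis of_nat_le_iff of_nat_numeral of_nat_power)
    finally have le: "1 \<le> real (card A) * (1 / 2 ^ j)" by (simp add: field_simps)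
    have "?b j {} = (1 - 1 / 2 ^ j) ^ card A" by (simp add: bernoulli_weight_def)
    also have "\<dots> \<le> exp (- (1 / 2 ^ j)) ^ card A"
      using exp_ge_add_one_self[of "- (1 / 2 ^ j)"] by (intro power_mono) auto
    also have "\<dots> = exp (- (real (card A) * (1 / 2 ^ j)))" 
      by (simp add: exp_of_nat_mult[symmetric])
    also have "\<dots> \<le> exp (- 1)" using le by simp
    also have "\<dots> \<le> 1 / 2" 
      using exp_ge_add_one_self[of 1] by (simp add: exp_minus field_simps)
    finally show ?thesis .
  qed
  have "real L / 2 = (\<Sum>j=1..L. 1 - 1 / 2)" by simp
  also have "\<dots> \<le> (\<Sum>j=1..L. 1 - ?b j {})"
    using empty by (intro sum_mono) force
  also have "\<dots> = (\<Sum>j=1..L. \<Sum>S\<in>Pow A - {{}}. ?b j S)"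
    using assms(1) by (intro sum.cong) (simp_all add: sum_diff1 sum_bernoulli_weight)
  also have "\<dots> = (\<Sum>S\<in>Pow A - {{}}. \<Sum>j=1..L. ?b j S)" by (rule sum.swap)
  finally show "1 / 2 \<le> (\<Sum>S\<in>Pow A - {{}}. ?w S)"
    using assms(2) unfolding sum_divide_distrib[symmetric] by (simp add: field_simps)
qed

section \<open>Oblivious executions\<close>

text \<open>Rounds are counted from 0 here: \<open>r\<close> is the number of preceding rounds, all without reception.\<close>

definition oblivious_transmitters ::
    "nat \<Rightarrow> ('s, 'm) protocol \<Rightarrow> (nat \<Rightarrow> 's) \<Rightarrow> nat \<Rightarrow> nat \<Rightarrow> nat set" where
  "oblivious_transmitters n P \<omega> r c =
     {u \<in> {1..n}. transmits_on (act P u (\<omega> u) (replicate r None)) c}"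

text \<open>A reception needs a lone transmitter. Only nodes of \<open>S\<close> transmit, by
  validity on channels in \<open>{1..C}\<close>, so \<open>none\<close> excludes receptions and each
  round appends \<open>None\<close> everywhere.\<close>

lemma history_oblivious:
  assumes P: "valid_protocol n C P" and S: "S \<subseteq> {1..n}"
    and \<omega>: "\<omega> \<in> space (\<Pi>\<^sub>M u\<in>{1..n}. seed P u)"
    and none: "\<And>r c. r < R \<Longrightarrow> c \<in> {1..C} \<Longrightarrow> card (S \<inter> oblivious_transmitters n P \<omega> r c) \<noteq> 1"
    and "r \<le> R"
  shows "history n P S \<omega> r = (\<lambda>u. replicate r None)"
  using \<open>r \<le> R\<close>
proof (induction r)
  case (Suc r)
  let ?a = "node_action P S \<omega> (\<lambda>u. replicate r None)"
  have "\<not> receives_from n ?a u v c m" for u v c m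
  proof
    assume rec: "receives_from n ?a u v c m"
    have v: "v \<in> S" and vc: "act P v (\<omega> v) (replicate r None) = Transmit c m"
      using rec by (auto simp: receives_from_def node_action_def split: if_splits)
    have "v \<in> {1..n}" using v S by auto
    moreover have "\<omega> v \<in> space (seed P v)"
      using \<omega> \<open>v \<in> {1..n}\<close> by (auto simp: space_PiM)
    ultimately have "channel (act P v (\<omega> v) (replicate r None)) \<in> {1..C}"
      using P unfolding valid_protocol_def by blast
    then have c: "c \<in> {1..C}" by (simp add: vc)
    \<comment> \<open>The exclusion clause of \<open>receives_from\<close> leaves out the receiver
      \<open>u\<close>; but \<open>u\<close> listens on \<open>c\<close>, so it is no second
      transmitter.\<close>
    have uniq: "w = v" if "w \<in> S" "transmits_on (?a w) c" for w
      using rec that S unfolding receives_from_def transmits_on_def by force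
    have "S \<inter> oblivious_transmitters n P \<omega> r c = {v}"
    proof (intro equalityI subsetI)
      fix w assume "w \<in> S \<inter> oblivious_transmitters n P \<omega> r c"
      then have "w \<in> S" "transmits_on (?a w) c"
        by (simp_all add: oblivious_transmitters_def node_action_def)
      then show "w \<in> {v}" using uniq by simp
    next
      fix w assume "w \<in> {v}"
      then show "w \<in> S \<inter> oblivious_transmitters n P \<omega> r c"
        using v vc \<open>v \<in> {1..n}\<close> by (simp add: oblivious_transmitters_def transmits_on_def)
    qed
    then show False using none[OF _ c, of r] Suc.prems by simp
  qed
  then show ?case using Suc by (simp add: reception_def replicate_append_same)
qed simp

text \<open>Success concerns channel 1 only, but lone transmissions on other channels could deliver
  messages and end obliviousness. Round \<open>r\<close> has index \<open>r - 1\<close>, hence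
  \<open>Suc R\<close>.\<close>

lemma wakeup_time_ge:
  assumes P: "valid_protocol n C P" and "1 \<le> C" and S: "S \<subseteq> {1..n}"
    and \<omega>: "\<omega> \<in> space (\<Pi>\<^sub>M u\<in>{1..n}. seed P u)"
    and none: "\<And>r c. r < R \<Longrightarrow> c \<in> {1..C} \<Longrightarrow> card (S \<inter> oblivious_transmitters n P \<omega> r c) \<noteq> 1"
  shows "enat (Suc R) \<le> wakeup_time n P S \<omega>"
  unfolding wakeup_time_def
proof (rule INF_greatest)
  fix r assume "r \<in> {r. 1 \<le> r \<and> wakeup_round n P S \<omega> r}"
  then have r: "1 \<le> r" "wakeup_round n P S \<omega> r" by auto
  have False if "r \<le> R"
  proof -
    have "round_action n P S \<omega> r = node_action P S \<omega> (\<lambda>u. replicate (r - 1) None)"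
      using history_oblivious[OF P S \<omega> none, where r = "r - 1"] that by (simp add: round_action_def)
    then have "\<exists>!u. u \<in> S \<inter> oblivious_transmitters n P \<omega> (r - 1) 1"
      using r(2) S unfolding wakeup_round_def oblivious_transmitters_def node_action_def
      by (auto 4 4)
    then have "card (S \<inter> oblivious_transmitters n P \<omega> (r - 1) 1) = 1"
      by (simp add: card_1_singleton_iff) blast
    moreover have "r - 1 < R" using r(1) that by simp
    ultimately show False using none[of "r - 1" 1] \<open>1 \<le> C\<close> by auto
  qed
  then show "enat (Suc R) \<le> enat r" by force
qed

text \<open>The event is a finite Boolean combination of events that each depend on the seed of one
  node.\<close>

lemma sets_oblivious_transmitters_card_1:
  assumes P: "valid_protocol n C P" and S: "S \<subseteq> {1..n}"
  shows "{\<omega> \<in> space (\<Pi>\<^sub>M u\<in>{1..n}. seed P u). card (S \<inter> oblivious_transmitters n P \<omega> r c) = 1}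
           \<in> sets (\<Pi>\<^sub>M u\<in>{1..n}. seed P u)" (is "_ \<in> sets ?M")
proof -
  let ?T = "\<lambda>u \<omega>. transmits_on (act P u (\<omega> u) (replicate r None)) c"
  have fin: "finite S" using S finite_subset by blast
  have T: "Measurable.pred ?M (?T u)" if "u \<in> S" for u
  proof (rule measurable_compose[where N = "count_space UNIV" and g = "\<lambda>a. transmits_on a c"])
    have u: "u \<in> {1..n}" using that S by blast
    have "(\<lambda>s. act P u s (replicate r None)) \<in> measurable (seed P u) (count_space UNIV)"
      using P u unfolding valid_protocol_def by blast
    with measurable_component_singleton[OF u]
    show "(\<lambda>\<omega>. act P u (\<omega> u) (replicate r None)) \<in> measurable ?M (count_space UNIV)"
      by (rule measurable_compose)
  qed simp
  have "S \<inter> oblivious_transmitters n P \<omega> r c = {u \<in> S. ?T u \<omega>}" for \<omega>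
    using S unfolding oblivious_transmitters_def by blast
  moreover have "card {u \<in> S. ?T u \<omega>} = 1 \<longleftrightarrow>
      (\<exists>u\<in>S. ?T u \<omega> \<and> (\<forall>v\<in>S. ?T v \<omega> \<longrightarrow> v = u))" for \<omega>
    unfolding is_singleton_altdef[symmetric] is_singleton_def by blast
  moreover have "{\<omega> \<in> space ?M. \<exists>u\<in>S. ?T u \<omega> \<and> (\<forall>v\<in>S. ?T v \<omega> \<longrightarrow> v = u)} \<in> sets ?M"
    using fin T unfolding pred_def
    by (intro sets.sets_Collect_finite_Ex sets.sets_Collect_conj sets.sets_Collect_finite_All
        sets.sets_Collect_imp sets.sets_Collect_const)
  ultimately show ?thesis by simp
qed

section \<open>Averaging over seeds and activated sets\<close>

lemma expected_wakeup_time_ge: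
  assumes P: "valid_protocol n C P" and C: "1 \<le> C" and L: "0 < L" "2 ^ L \<le> n"
    and R: "real R < real L / (8 * real C)"
  obtains S where "S \<noteq> {}" "S \<subseteq> {1..n}"
    "ennreal (real (Suc R) / 2) \<le> expected_wakeup_time n P S"
proof -
  define M where "M = (\<Pi>\<^sub>M u\<in>{1..n}. seed P u)"
  interpret prob_space M
    unfolding M_def using P by (intro prob_space_PiM) (auto simp: valid_protocol_def)
  \<comment> \<open>Outside \<open>H S\<close> the execution is oblivious and unsolved for
    \<open>R\<close> rounds; inside \<open>H S\<close> nothing is claimed.\<close>
  define E where
    "E S r c = {\<omega> \<in> space M. card (S \<inter> oblivious_transmitters n P \<omega> r c) = 1}" for S r c
  define H where "H S = (\<Union>r<R. \<Union>c\<in>{1..C}. E S r c)" for S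
  let ?N = "Pow {1..n} - {{}}"
  have E[measurable]: "E S r c \<in> events" if "S \<in> ?N" for S r c
    using sets_oblivious_transmitters_card_1[OF P] that by (auto simp: E_def M_def)
  obtain w :: "nat set \<Rightarrow> real" where w: "\<And>S. 0 \<le> w S"
    "1 / 2 \<le> (\<Sum>S\<in>?N. w S)"
    "\<And>F. F \<subseteq> {1..n} \<Longrightarrow> (\<Sum>S | S \<subseteq> {1..n} \<and> card (S \<inter> F) = 1. w S) \<le> 2 / L"
    using rarely_singleton_weight[of "{1..n}" L] L by auto
  \<comment> \<open>For fixed seeds the oblivious transmitters do not depend on \<open>S\<close>, so
    the bound on \<open>w\<close> applies pointwise under the integral.\<close>
  have avg: "(\<Sum>S\<in>?N. w S * prob (E S r c)) \<le> 2 / L" for r c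
  proof -
    have "(\<Sum>S\<in>?N. w S * prob (E S r c)) = (\<Sum>S\<in>?N. \<integral>\<omega>. w S * indicator (E S r c) \<omega> \<partial>M)"
      using E by (intro sum.cong) (auto simp: sets.sets_into_space Int_absorb1)
    also have "\<dots> = (\<integral>\<omega>. (\<Sum>S\<in>?N. w S * indicator (E S r c) \<omega>) \<partial>M)"
      using E by (intro Bochner_Integration.integral_sum[symmetric] integrable_mult_right
          integrable_real_indicator) (auto simp: emeasure_eq_measure)
    also have "\<dots> \<le> (\<integral>\<omega>. 2 / L \<partial>M)"
    proof (intro integral_mono)
      show "integrable M (\<lambda>\<omega>. \<Sum>S\<in>?N. w S * indicator (E S r c) \<omega>)"
        using E by (intro Bochner_Integration.integrable_sum integrable_mult_right
          integrable_real_indicator) (auto simp: emeasure_eq_measure)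
      fix \<omega> assume "\<omega> \<in> space M"
      then have "(\<Sum>S\<in>?N. w S * indicator (E S r c) \<omega>)
          = (\<Sum>S | S \<subseteq> {1..n} \<and> card (S \<inter> oblivious_transmitters n P \<omega> r c) = 1. w S)"
        by (intro sum.mono_neutral_cong_right) (auto simp: E_def indicator_def)
      also have "\<dots> \<le> 2 / L" by (rule w(3)) (auto simp: oblivious_transmitters_def)
      finally show "(\<Sum>S\<in>?N. w S * indicator (E S r c) \<omega>) \<le> 2 / L" .
    qed auto
    finally show ?thesis by (simp add: prob_space)
  qed
  have H_le: "prob (H S) \<le> (\<Sum>r<R. \<Sum>c\<in>{1..C}. prob (E S r c))" if "S \<in> ?N" for S
  proof -
    have "prob (H S) \<le> (\<Sum>r<R. prob (\<Union>c\<in>{1..C}. E S r c))"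
      unfolding H_def using E[OF that] by (intro finite_measure_subadditive_finite) auto
    also have "\<dots> \<le> (\<Sum>r<R. \<Sum>c\<in>{1..C}. prob (E S r c))"
      using E[OF that] by (intro sum_mono finite_measure_subadditive_finite) auto
    finally show ?thesis .
  qed
  \<comment> \<open>Otherwise the weighted average of \<open>prob (H S)\<close> is at least
    \<open>1 / 4\<close>, while the union bound gives at most \<open>2 * R * C / L\<close>; the 8 in
    the bound on \<open>R\<close> makes these clash.\<close>
  have "\<exists>S\<in>?N. prob (H S) \<le> 1 / 2"
  proof (rule ccontr)
    assume "\<not> ?thesis"
    then have big: "1 / 2 \<le> prob (H S)" if "S \<in> ?N" for S
      using that by (meson less_imp_le not_le)
    have "1 / 4 \<le> (\<Sum>S\<in>?N. w S) * (1 / 2)" using w(2) by simp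
    also have "\<dots> = (\<Sum>S\<in>?N. w S * (1 / 2))" by (rule sum_distrib_right)
    also have "\<dots> \<le> (\<Sum>S\<in>?N. w S * (\<Sum>r<R. \<Sum>c\<in>{1..C}. prob (E S r c)))"
      using order_trans[OF big H_le] w(1) by (intro sum_mono mult_left_mono)
    also have "\<dots> = (\<Sum>r<R. \<Sum>S\<in>?N. \<Sum>c\<in>{1..C}. w S * prob (E S r c))"
      unfolding sum_distrib_left by (rule sum.swap)
    also have "\<dots> = (\<Sum>r<R. \<Sum>c\<in>{1..C}. \<Sum>S\<in>?N. w S * prob (E S r c))"
      by (intro sum.cong refl sum.swap)
    also have "\<dots> \<le> (\<Sum>r<R. \<Sum>c\<in>{1..C}. 2 / L)" by (intro sum_mono avg)
    also have "\<dots> = 2 * real R * real C / L" by simp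
    also have "\<dots> < 1 / 4" using R C L by (simp add: field_simps)
    finally show False by simp
  qed
  then obtain S where S: "S \<in> ?N" "prob (H S) \<le> 1 / 2" by blast
  have H: "H S \<in> events" unfolding H_def using E[OF S(1)] by auto
  \<comment> \<open>As in Markov's inequality: the time is at least \<open>Suc R\<close> off
    \<open>H S\<close>, an event of probability at least \<open>1 / 2\<close>.\<close>
  have "ennreal (real (Suc R) / 2) \<le> ennreal (real (Suc R) * prob (space M - H S))"
    using prob_compl[OF H] S(2) mult_left_mono[of "1 / 2" "prob (space M - H S)" "real (Suc R)"]
    by (intro ennreal_leI) auto
  also have "\<dots> = (\<integral>\<^sup>+\<omega>. ennreal (real (Suc R)) * indicator (space M - H S) \<omega> \<partial>M)"
    using H by (subst nn_integral_cmult_indicator) (auto simp: emeasure_eq_measure ennreal_mult)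
  also have "\<dots> \<le> expected_wakeup_time n P S"
    unfolding expected_wakeup_time_def M_def[symmetric]
  proof (rule nn_integral_mono)
    fix \<omega> assume \<omega>: "\<omega> \<in> space M"
    show "ennreal (real (Suc R)) * indicator (space M - H S) \<omega>
        \<le> ennreal_of_enat (wakeup_time n P S \<omega>)"
    proof (cases "\<omega> \<in> H S")
      case False
      then have "enat (Suc R) \<le> wakeup_time n P S \<omega>"
        using S(1) by (intro wakeup_time_ge[OF P C _ \<omega>[unfolded M_def]]) (use \<omega> in \<open>auto simp: H_def E_def\<close>)
      then have "ennreal_of_enat (enat (Suc R)) \<le> ennreal_of_enat (wakeup_time n P S \<omega>)"
        by (simp only: ennreal_of_enat_le_iff)
      then show ?thesis
        using False \<omega> by (simp only: ennreal_of_enat_enat ennreal_of_nat_eq_real_of_nat)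
          (simp add: indicator_def)
    qed simp
  qed
  finally show thesis using that S(1) by blast
qed

section \<open>Passage to the asymptotic bound\<close>

theorem theorem7p4:
  fixes A :: "nat \<Rightarrow> nat \<Rightarrow> ('s, 'm::countable) protocol"
    and f :: "nat \<Rightarrow> nat \<Rightarrow> real"
  assumes "solves_wakeup_in A f"
  shows "\<forall>C::nat. C \<ge> 1 \<longrightarrow> (\<lambda>n. f n C) \<in> \<Omega>(\<lambda>n. log 2 (real n) / real C + 1)"
proof (intro allI impI)
  fix C :: nat assume C: "1 \<le> C"
  \<comment> \<open>With \<open>T = Suc R\<close>, both \<open>x \<le> T\<close> and
    \<open>1 \<le> T\<close>, so the bracket is at most \<open>8 * x + 2 \<le> 10 * T\<close>, while
    \<open>T / 2 \<le> f n C\<close>: hence 20.\<close>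
  have bound: "1 / 20 * (log 2 (real n) / real C + 1) \<le> f n C" if n: "2 \<le> n" for n
  proof -
    define L where "L = nat \<lfloor>log 2 (real n)\<rfloor>"
    have log_ge: "1 \<le> log 2 (real n)" using n by (simp add: le_log_iff)
    then have L: "0 < L" "real L \<le> log 2 (real n)" "log 2 (real n) \<le> real L + 1"
      unfolding L_def by (simp_all add: le_nat_floor less_imp_le nat_floor_neg; linarith)+
    have "2 powr real L \<le> real n" using L(2) n by (simp add: le_log_iff)
    then have "2 ^ L \<le> n" 
      by (metis numeral_power_le_of_nat_cancel_iff powr_realpow zero_less_numeral)
    define x where "x = real L / (8 * real C)"
    \<comment> \<open>The largest natural number strictly below \<open>x\<close>; positivity of
      \<open>x\<close> keeps \<open>nat\<close> from truncating.\<close>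
    define R where "R = nat (\<lceil>x\<rceil> - 1)"
    have "0 < x" using L C by (simp add: x_def)
    then have R: "real R < x" "x \<le> real (Suc R)" unfolding R_def by linarith+
    have valid: "valid_protocol n C (A n C)"
      and upper: "\<And>S. S \<noteq> {} \<Longrightarrow> S \<subseteq> {1..n} \<Longrightarrow> expected_wakeup_time n (A n C) S \<le> ennreal (f n C)"
      using assms n C unfolding solves_wakeup_in_def by auto
    obtain S where "S \<noteq> {}" "S \<subseteq> {1..n}"
      "ennreal (real (Suc R) / 2) \<le> expected_wakeup_time n (A n C) S"
      using expected_wakeup_time_ge[OF valid C L(1) \<open>2 ^ L \<le> n\<close>] R(1) unfolding x_def by blast
    then have "ennreal (real (Suc R) / 2) \<le> ennreal (f n C)" using upper order_trans by blast
    \<comment> \<open>\<open>ennreal\<close> sends negative reals to 0; the positive left side rules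
      out that case for \<open>f n C\<close>.\<close>
    then have le: "real (Suc R) / 2 \<le> f n C" 
      by (subst (asm) ennreal_le_iff2) auto
    have "log 2 (real n) / real C \<le> (real L + 1) / real C"
      using L(3) by (intro divide_right_mono) auto
    also have "\<dots> = 8 * x + 1 / real C" using C by (simp add: x_def field_simps)
    also have "\<dots> \<le> 8 * x + 1" using C by simp
    finally show ?thesis using le R(2) by simp
  qed
  show "(\<lambda>n. f n C) \<in> \<Omega>(\<lambda>n. log 2 (real n) / real C + 1)"
  proof (rule landau_omega.bigI[of "1 / 20"])
    show "\<forall>\<^sub>F n in sequentially.
        1 / 20 * norm (log 2 (real n) / real C + 1) \<le> norm (f n C)"
      using eventually_ge_at_top[of 2]
    proof eventually_elim
      case (elim n)
      then have "0 \<le> log 2 (real n) / real C + 1" by simp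
      then show ?case using bound[OF elim] by simp
    qed
  qed simp
qed

end
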